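(* Let $k,g\in\mathbb{N}$ with $g$ even and $k\ge 2$. There is a bipartite graph $H_k$ and a $k$-list assignment $L$ on $H_k$ such that $H_k$ is not $L$-colorable, even though $\left|\bigcup_{v\in V(H_k)}L(v)\right|=2k-1$ and $H_k$ has girth at least $g$ with each proper subgraph of $H_k$ having average degree at most $2(k-1)$.
   Context: Graphs are finite and simple; $\mathbb{N}$ is the set of positive integers. The girth of a graph is the length of a shortest cycle ($\infty$ if there is none). A $k$-list assignment $L$ on a graph $G$ assigns to each vertex $v$ a set $L(v)$ of exactly $k$ colors; $G$ is $L$-colorable if it has a proper coloring $f$ with $f(v)\in L(v)$ for all $v$. The average degree of a (nonempty) graph $H$ is $2|E(H)|/|V(H)|$. A proper subgraph of $G$ is any subgraph with at least one vertex that is different from $G$. *)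

theory Defs
  imports Complex_Main "HOL-Library.Extended_Nat"
begin

text \<open>A graph is given by its vertex set \<open>V\<close> and its edge set \<open>E\<close>, whose members are
  two-element sets of vertices.\<close>

definition fin_simple_graph :: "'v set \<Rightarrow> 'v set set \<Rightarrow> bool" where
  "fin_simple_graph V E \<longleftrightarrow> finite V \<and> (\<forall>e\<in>E. e \<subseteq> V \<and> card e = 2)"

definition bipartite :: "'v set \<Rightarrow> 'v set set \<Rightarrow> bool" where
  "bipartite V E \<longleftrightarrow>
     (\<exists>A B. A \<union> B = V \<and> A \<inter> B = {} \<and> (\<forall>e\<in>E. \<exists>a\<in>A. \<exists>b\<in>B. e = {a, b}))"

text \<open>A cycle is given by its vertices in cyclic order, without repeating the first one at the
  end, so its length is the length of the list.\<close>

definition is_cycle :: "'v set \<Rightarrow> 'v set set \<Rightarrow> 'v list \<Rightarrow> bool" where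
  "is_cycle V E c \<longleftrightarrow> 3 \<le> length c \<and> distinct c \<and> set c \<subseteq> V \<and>
     (\<forall>i<length c. {c ! i, c ! (Suc i mod length c)} \<in> E)"

text \<open>The infimum of the empty set in \<open>enat\<close> is \<open>\<infinity>\<close>, the girth of a forest.\<close>

definition girth :: "'v set \<Rightarrow> 'v set set \<Rightarrow> enat" where
  "girth V E = (INF c\<in>{c. is_cycle V E c}. enat (length c))"

definition subgraph :: "'v set \<Rightarrow> 'v set set \<Rightarrow> 'v set \<Rightarrow> 'v set set \<Rightarrow> bool" where
  "subgraph V' E' V E \<longleftrightarrow> fin_simple_graph V' E' \<and> V' \<subseteq> V \<and> E' \<subseteq> E"

text \<open>A proper subgraph may still span all of \<open>V\<close>.\<close>

definition proper_subgraph :: "'v set \<Rightarrow> 'v set set \<Rightarrow> 'v set \<Rightarrow> 'v set set \<Rightarrow> bool" where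
  "proper_subgraph V' E' V E \<longleftrightarrow> subgraph V' E' V E \<and> V' \<noteq> {} \<and> (V', E') \<noteq> (V, E)"

definition average_degree :: "'v set \<Rightarrow> 'v set set \<Rightarrow> real" where
  "average_degree V E = 2 * real (card E) / real (card V)"

definition list_assignment :: "nat \<Rightarrow> 'v set \<Rightarrow> ('v \<Rightarrow> 'c set) \<Rightarrow> bool" where
  "list_assignment k V L \<longleftrightarrow> (\<forall>v\<in>V. finite (L v) \<and> card (L v) = k)"

definition proper_coloring :: "'v set \<Rightarrow> 'v set set \<Rightarrow> ('v \<Rightarrow> 'c) \<Rightarrow> bool" where
  "proper_coloring V E f \<longleftrightarrow> (\<forall>u\<in>V. \<forall>v\<in>V. {u, v} \<in> E \<longrightarrow> f u \<noteq> f v)"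

definition list_colorable :: "'v set \<Rightarrow> 'v set set \<Rightarrow> ('v \<Rightarrow> 'c set) \<Rightarrow> bool" where
  "list_colorable V E L \<longleftrightarrow> (\<exists>f. proper_coloring V E f \<and> (\<forall>v\<in>V. f v \<in> L v))"

end

theory Submission
  imports Defs "HOL-Library.FuncSet" "HOL-Library.Nat_Bijection"
begin

text \<open>The graph is a tree with extra edges from its leaves to ancestors. Its vertices are words of
  colours. A vertex \<open>w\<close> other than the root and the leaves has as its list the last letter of \<open>w\<close>,
  to be thought of as the colour of its parent, and a set \<open>S w\<close> of \<open>k - 1\<close> further colours; it has
  one child \<open>w @ [c]\<close> for each \<open>c \<in> S w\<close>. The root chooses from \<open>k\<close> colours and has \<open>k\<close> children.
  In a proper colouring a vertex reached from its parent by the parent's colour must choose from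
  \<open>S w\<close>, so following the chosen colours gives a walk from the root to a leaf, and the word of this
  leaf spells out the colours of all its ancestors. The leaf is joined to its parent and to \<open>k - 1\<close>
  other ancestors. If the letters of the word at these \<open>k\<close> positions are distinct, they can serve as
  the list of the leaf, and then no colour is left for it (\<open>no_proper_choice\<close>).

  What remains is to arrange large girth and distinct letters with few colours, and to check the
  density.

  Girth. It is convenient to bound the size of nonempty edge sets with all degrees even, because this
  property survives contraction. Let every leaf of a tree \<open>Z\<close> have many extra edges to ancestors, and
  hang a block below every leaf of \<open>Z\<close> such that each leaf of the block takes over just one of the
  extra edges. If \<open>Z\<close> has girth at least \<open>g\<close> and the blocks have girth at least \<open>g + 1\<close>, so has the
  result (\<open>stack_girth\<close>): a cycle that leaves its block becomes an even edge set of \<open>Z\<close> when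
  the blocks are contracted, and at least one edge is lost since distinct edges enter a block at
  distinct vertices. Each stacking raises
  the number of extra edges per leaf by one, so an outer induction on the girth and an inner induction
  on this number, starting from a plain tree, gives everything (\<open>exists_augmentation\<close>).

  Distinct letters. When \<open>S\<close> is chosen during the stacking, the word of a leaf \<open>u\<close> of \<open>Z\<close> is known
  before the block below \<open>u\<close> is built. By the pigeonhole principle many of the extra edges of \<open>u\<close> lead
  to ancestors of one colour; only these are used, and this colour is forbidden for the choices in the
  block (\<open>exists_rainbow_augmentation\<close>). At most \<open>k - 1\<close> forbidden colours and the parent's colour have
  to be avoided, which leaves \<open>k - 1\<close> of \<open>2 * k - 1\<close> colours. Fewer than \<open>2 * k - 1\<close> colours cannot
  occur, because a bipartite graph is colourable from lists of size \<open>k\<close> within \<open>2 * k - 2\<close> colours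
  (\<open>many_colours_if_not_list_colorable\<close>).

  Density. Let a leaf own its extra edges and any other vertex the edges to its children. Every edge
  is owned by one of its ends, every vertex owns \<open>k - 1\<close> edges, and only the root owns one more. A
  subgraph with more than \<open>k - 1\<close> times as many edges as vertices thus contains the root and all edges
  owned by its vertices, and then it is everything (\<open>proper_part_sparse\<close>).\<close>

section \<open>Girth through Eulerian edge sets\<close>

text \<open>The edges are of an arbitrary type with a map to their ends, so that the same notion serves sets
  of vertices as well as the encoded tree edges used below.\<close>

definition eulerian :: "('e \<Rightarrow> 'v set) \<Rightarrow> 'e set \<Rightarrow> bool" where
  "eulerian ends F \<longleftrightarrow> (\<forall>v. even (card {e \<in> F. v \<in> ends e}))"

definition eulerian_girth_ge :: "('e \<Rightarrow> 'v set) \<Rightarrow> 'e set \<Rightarrow> nat \<Rightarrow> bool" where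
  "eulerian_girth_ge ends E g \<longleftrightarrow>
     (\<forall>F \<subseteq> E. finite F \<longrightarrow> F \<noteq> {} \<longrightarrow> eulerian ends F \<longrightarrow> g \<le> card F)"

text \<open>The edge set of a cycle is Eulerian, with one edge for each vertex of the cycle.\<close>

lemma girth_ge_if_eulerian:
  assumes "eulerian_girth_ge (\<lambda>e. e) E g"
  shows "enat g \<le> girth V E"
  unfolding girth_def
proof (rule INF_greatest)
  fix c assume "c \<in> {c. is_cycle V E c}"
  then have n: "3 \<le> length c" and dist: "distinct c"
    and edge: "\<And>i. i < length c \<Longrightarrow> {c ! i, c ! (Suc i mod length c)} \<in> E"
    by (auto simp: is_cycle_def)
  define n where "n = length c"
  define e where "e i = {c ! i, c ! (Suc i mod n)}" for i
  define F where "F = e ` {..<n}"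
  have nth_eq: "c ! i = c ! j \<longleftrightarrow> i = j" if "i < n" "j < n" for i j
    using that dist by (simp add: n_def nth_eq_iff_index_eq)
  have "even (card {x \<in> F. v \<in> x})" for v
  proof (cases "v \<in> set c")
    case False
    have "e i \<subseteq> set c" if "i < n" for i
      using that by (auto simp: e_def n_def intro!: nth_mem mod_less_divisor)
    then have "{x \<in> F. v \<in> x} = {}" using False by (auto simp: F_def)
    then show ?thesis by (metis card.empty even_zero)
  next
    case True
    then obtain m where m: "m < n" "v = c ! m" by (auto simp: in_set_conv_nth n_def)
    define p where "p = (if m = 0 then n - 1 else m - 1)"
    have p: "p < n" "Suc p mod n = m" "p \<noteq> m" "p \<noteq> Suc m mod n" "Suc m mod n < n"
      using n m by (auto simp: p_def n_def mod_Suc split: if_splits)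
    have pre: "i = p" if "i < n" "Suc i mod n = m" for i
      using that m n by (auto simp: p_def n_def mod_Suc split: if_splits)
    have "v \<in> e i \<longleftrightarrow> i = m \<or> i = p" if i: "i < n" for i
    proof -
      have "Suc i mod n < n" using i by (intro mod_less_divisor) simp
      then have "v \<in> e i \<longleftrightarrow> m = i \<or> m = Suc i mod n"
        using nth_eq[OF m(1) i] nth_eq[OF m(1), of "Suc i mod n"] m(2) by (simp add: e_def)
      then show ?thesis using pre[OF i] p(2) by metis
    qed
    then have "{x \<in> F. v \<in> x} = {e m, e p}" using m(1) p(1) unfolding F_def by blast
    moreover have "c ! p \<notin> e m" "c ! p \<in> e p"
      using m p nth_eq by (auto simp: e_def)
    then have "e m \<noteq> e p" by auto
    ultimately show ?thesis by simp
  qed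
  then have "eulerian (\<lambda>e. e) F" by (simp add: eulerian_def)
  moreover have "F \<subseteq> E" using edge by (auto simp: F_def e_def n_def)
  moreover have "F \<noteq> {}" "finite F" using n by (auto simp: F_def n_def lessThan_empty_iff)
  ultimately have "g \<le> card F" using assms by (auto simp: eulerian_girth_ge_def)
  also have "\<dots> \<le> n" unfolding F_def using card_image_le[of "{..<n}" e] by simp
  finally show "enat g \<le> enat (length c)" by (simp add: n_def)
qed

section \<open>Trees of words with links to ancestors\<close>

text \<open>An edge is a pair \<open>(w, i)\<close> of a word and a position; it joins \<open>w\<close> to its prefix of length \<open>i\<close>. So
  every edge knows its lower end, and the letter \<open>w ! i\<close> is the one chosen at its upper end.\<close>

definition ends :: "'a list \<times> nat \<Rightarrow> 'a list set" where
  "ends e = {fst e, take (snd e) (fst e)}"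

definition nodes :: "('a list \<Rightarrow> 'a set) \<Rightarrow> nat \<Rightarrow> 'a list set" where
  "nodes S h = {w. length w \<le> h \<and> (\<forall>i<length w. w ! i \<in> S (take i w))}"

definition leaves :: "('a list \<Rightarrow> 'a set) \<Rightarrow> nat \<Rightarrow> 'a list set" where
  "leaves S h = {w \<in> nodes S h. length w = h}"

text \<open>\<open>Suc i = length w\<close> describes the edge from \<open>w\<close> to its parent; \<open>J w\<close> gives the depths of the
  further ancestors to which a leaf \<open>w\<close> is joined.\<close>

definition links ::
  "('a list \<Rightarrow> 'a set) \<Rightarrow> ('a list \<Rightarrow> nat set) \<Rightarrow> nat \<Rightarrow> ('a list \<times> nat) set" where
  "links S J h = {(w, i). w \<in> nodes S h \<and> (Suc i = length w \<or> length w = h \<and> i \<in> J w)}"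

text \<open>The height \<open>h\<close> is going to be even. Ancestors at odd depth keep the graph bipartite, and
  \<open>Suc i < h\<close> keeps the new edges apart from those to parents.\<close>

definition augments :: "('a list \<Rightarrow> 'a set) \<Rightarrow> nat \<Rightarrow> ('a list \<Rightarrow> nat set) \<Rightarrow> nat \<Rightarrow> bool" where
  "augments S h J r \<longleftrightarrow>
     (\<forall>w \<in> leaves S h. finite (J w) \<and> card (J w) = r \<and> (\<forall>i \<in> J w. odd i \<and> Suc i < h))"

lemma augments_less: "augments S h J r \<Longrightarrow> w \<in> leaves S h \<Longrightarrow> i \<in> J w \<Longrightarrow> i < h"
  unfolding augments_def using Suc_lessD by blast

lemma take_mem_nodes: "w \<in> nodes S h \<Longrightarrow> take i w \<in> nodes S h"
  by (auto simp: nodes_def min_def)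

lemma take_mem_leaves: "w \<in> nodes S (a + b) \<Longrightarrow> a \<le> length w \<Longrightarrow> take a w \<in> leaves S a"
  by (auto simp: nodes_def leaves_def min_def)

lemma drop_mem_nodes:
  "w \<in> nodes S (a + b) \<Longrightarrow> a \<le> length w \<Longrightarrow> drop a w \<in> nodes (\<lambda>v. S (take a w @ v)) b"
  by (auto simp: nodes_def) (metis add.commute less_diff_conv take_add)

lemma drop_mem_leaves:
  "w \<in> leaves S (a + b) \<Longrightarrow> drop a w \<in> leaves (\<lambda>v. S (take a w @ v)) b"
  using drop_mem_nodes[of w S a b] by (auto simp: leaves_def)

lemma nodes_cong: "(\<And>w. length w < h \<Longrightarrow> S w = S' w) \<Longrightarrow> nodes S h = nodes S' h"
  by (auto simp: nodes_def)

lemma links_cong: "(\<And>w. length w < h \<Longrightarrow> S w = S' w) \<Longrightarrow> links S J h = links S' J h"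
  using nodes_cong[of h S S'] by (auto simp: links_def)

lemma finite_card_leaves:
  assumes "\<And>w. finite (S w) \<and> card (S w) \<le> d"
  shows "finite (leaves S h) \<and> card (leaves S h) \<le> d ^ h"
proof (induction h)
  case 0
  have "leaves S 0 = {[]}" by (auto simp: leaves_def nodes_def)
  then show ?case by simp
next
  case (Suc h)
  have eq: "leaves S (Suc h) = (\<lambda>(w, c). w @ [c]) ` (SIGMA w : leaves S h. S w)" (is "_ = ?R")
  proof
    show "leaves S (Suc h) \<subseteq> ?R"
    proof
      fix w assume w: "w \<in> leaves S (Suc h)"
      then have l: "length w = Suc h" by (auto simp: leaves_def)
      have "w = take h w @ [w ! h]"
        by (metis l lessI order_refl take_Suc_conv_app_nth take_all)
      moreover have "take h w \<in> leaves S h" "w ! h \<in> S (take h w)"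
        using w by (auto simp: leaves_def nodes_def min_def)
      ultimately show "w \<in> ?R" by (auto intro!: image_eqI[of _ _ "(take h w, w ! h)"])
    qed
    show "?R \<subseteq> leaves S (Suc h)"
      by (auto simp: leaves_def nodes_def nth_append less_Suc_eq)
  qed
  have "card (leaves S (Suc h)) \<le> card (SIGMA w : leaves S h. S w)"
    unfolding eq using Suc assms by (intro card_image_le) auto
  also have "\<dots> = (\<Sum>w\<in>leaves S h. card (S w))"
    using Suc assms by (intro card_SigmaI) auto
  also have "\<dots> \<le> (\<Sum>w\<in>leaves S h. d)"
    using assms by (intro sum_mono) auto
  also have "\<dots> \<le> d ^ Suc h" using Suc by simp
  finally show ?case unfolding eq using Suc assms by auto
qed

lemma finite_nodes:
  assumes "\<And>w. finite (S w)"
  shows "finite (nodes S h)"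
proof (induction h)
  case 0
  have "nodes S 0 = {[]}" by (auto simp: nodes_def)
  then show ?case by simp
next
  case (Suc h)
  have "nodes S (Suc h) \<subseteq> insert [] ((\<lambda>(w, c). w @ [c]) ` (SIGMA w : nodes S h. S w))"
  proof
    fix w assume w: "w \<in> nodes S (Suc h)"
    show "w \<in> insert [] ((\<lambda>(w, c). w @ [c]) ` (SIGMA w : nodes S h. S w))"
    proof (cases w rule: rev_cases)
      case (snoc u c)
      then have letter: "w ! i \<in> S (take i w)" if "i \<le> length u" for i
        using w that by (auto simp: nodes_def)
      have "c \<in> S u" using letter[of "length u"] snoc by simp
      moreover have "u ! i \<in> S (take i u)" if "i < length u" for i
        using letter[of i] that snoc by (simp add: nth_append)
      ultimately show ?thesis using snoc w by (auto simp: nodes_def)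
    qed simp
  qed
  then show ?case using Suc assms by (auto intro: finite_subset)
qed

text \<open>A deepest lower end has degree one.\<close>

lemma not_eulerian_if_unique_uplinks:
  assumes "finite F" "F \<noteq> {}"
    and less: "\<And>w i. (w, i) \<in> F \<Longrightarrow> i < length w"
    and uniq: "\<And>w i j. (w, i) \<in> F \<Longrightarrow> (w, j) \<in> F \<Longrightarrow> i = j"
  shows "\<not> eulerian ends F"
proof
  assume eul: "eulerian ends F"
  define n where "n = Max ((length \<circ> fst) ` F)"
  have "n \<in> (length \<circ> fst) ` F" unfolding n_def using assms by (intro Max_in) auto
  then obtain w i where wi: "(w, i) \<in> F" "length w = n" by auto
  have max: "length u \<le> n" if "(u, j) \<in> F" for u j
    unfolding n_def using that assms by (intro Max_ge) (auto intro: rev_image_eqI)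
  have "{e \<in> F. w \<in> ends e} = {(w, i)}"
  proof -
    have "(u, j) = (w, i)" if "(u, j) \<in> F" "w \<in> ends (u, j)" for u j
    proof (cases "u = w")
      case True then show ?thesis using uniq wi that by auto
    next
      case False
      then have "w = take j u" using that by (auto simp: ends_def)
      then have "length w = j" using less[OF that(1)] by simp
      then show ?thesis using max[OF that(1)] less[OF that(1)] wi by simp
    qed
    then have "e = (w, i)" if "e \<in> F" "w \<in> ends e" for e
      using that by (cases e) simp
    moreover have "w \<in> ends (w, i)" by (simp add: ends_def)
    ultimately show ?thesis using wi(1) by blast
  qed
  then have "card {e \<in> F. w \<in> ends e} = 1" by simp
  then show False using eul unfolding eulerian_def by (metis odd_one)
qed

section \<open>Stacking augmented trees\<close>

text \<open>Words of length at least \<open>a\<close> with the same prefix \<open>u\<close> of length \<open>a\<close> form the block below the leaf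
  \<open>u\<close> of the upper tree. The map \<open>\<phi>\<close> distributes the links of \<open>u\<close> injectively over the leaves of its
  block. An edge \<open>(w, i)\<close> lies inside a block if \<open>a \<le> i\<close>, and contracting the blocks takes an edge with
  \<open>i < a\<close> to \<open>(take a w, i)\<close>, an edge of the upper tree. If an Eulerian set lies inside the blocks, one
  block contains an Eulerian part of it. Otherwise its contraction is Eulerian in the upper tree and
  has at least \<open>g\<close> edges; and some edge lies inside a block, because without such edges no word would
  be the lower end of two edges.\<close>

lemma stack_girth:
  fixes S :: "'a list \<Rightarrow> 'a set"
  assumes "0 < b"
    and J: "\<And>w. w \<in> leaves S (a + b) \<Longrightarrow>
          J w = insert (\<phi> w) ((+) a ` JB (take a w) (drop a w))"
    and less: "\<And>w i. w \<in> leaves S (a + b) \<Longrightarrow> i \<in> J w \<Longrightarrow> i < a + b"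
    and \<phi>: "\<And>w. w \<in> leaves S (a + b) \<Longrightarrow> \<phi> w \<in> JZ (take a w) \<and> Suc (\<phi> w) < a"
    and inj: "\<And>w w'. w \<in> leaves S (a + b) \<Longrightarrow> w' \<in> leaves S (a + b) \<Longrightarrow>
          take a w = take a w' \<Longrightarrow> \<phi> w = \<phi> w' \<Longrightarrow> w = w'"
    and Z: "eulerian_girth_ge ends (links S JZ a) g"
    and B: "\<And>u. u \<in> leaves S a \<Longrightarrow>
          eulerian_girth_ge ends (links (\<lambda>v. S (u @ v)) (JB u) b) (Suc g)"
  shows "eulerian_girth_ge ends (links S J (a + b)) (Suc g)"
  unfolding eulerian_girth_ge_def
proof (intro allI impI)
  fix F assume F: "F \<subseteq> links S J (a + b)" "finite F" "F \<noteq> {}" "eulerian ends F"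
  have node: "w \<in> nodes S (a + b)" if "(w, i) \<in> F" for w i
    using that F(1) by (auto simp: links_def)
  have up: "Suc i = length w \<or> w \<in> leaves S (a + b) \<and> i \<in> J w" if "(w, i) \<in> F" for w i
    using that F(1) by (auto simp: links_def leaves_def)
  have lt: "i < length w" if "(w, i) \<in> F" for w i
    using up[OF that] less[of w i] by (auto simp: leaves_def)
  define out where "out = {e \<in> F. snd e < a}"
  define inn where "inn = {e \<in> F. a \<le> snd e}"
  have outup: "Suc i = length w \<and> length w \<le> a \<or> w \<in> leaves S (a + b) \<and> i = \<phi> w"
    if "(w, i) \<in> out" for w i
    using up[of w i] that J[of w] by (auto simp: out_def)
  have "out \<subseteq> F" by (auto simp: out_def)
  have fin: "finite out" "finite inn" using F by (auto simp: out_def inn_def)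
  show "Suc g \<le> card F"
  proof (cases "out = {}")
    case True
    then have ge: "a \<le> i" if "(w, i) \<in> F" for w i using that by (force simp: out_def)
    obtain w0 i0 where e0: "(w0, i0) \<in> F" using F(3) by auto
    define u where "u = take a w0"
    have lu: "length u = a" using ge[OF e0] lt[OF e0] by (simp add: u_def)
    have u: "u \<in> leaves S a"
      unfolding u_def using node[OF e0] ge[OF e0] lt[OF e0] by (intro take_mem_leaves) auto
    define G where "G = {e \<in> F. take a (fst e) = u}"
    define m where "m = (\<lambda>(w :: 'a list, i). (drop a w, i - a))"
    have finG: "finite G" "G \<noteq> {}" using F(2) e0 by (auto simp: G_def u_def)
    have Gw: "w = u @ drop a w \<and> a \<le> i" if "(w, i) \<in> G" for w i
      using that ge append_take_drop_id[of a w] by (auto simp: G_def)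
    have injm: "inj_on m G"
    proof (rule inj_onI)
      fix e e' assume *: "e \<in> G" "e' \<in> G" "m e = m e'"
      obtain w i w' i' where e: "e = (w, i)" "e' = (w', i')" by (cases e, cases e') auto
      have "drop a w = drop a w'" "i - a = i' - a" using * e by (auto simp: m_def)
      then show "e = e'" using Gw[of w i] Gw[of w' i'] * e by auto
    qed
    have "m ` G \<subseteq> links (\<lambda>v. S (u @ v)) (JB u) b"
    proof clarify
      fix v j w i assume wi: "(v, j) = m (w, i)" "(w, i) \<in> G"
      then have wF: "(w, i) \<in> F" "take a w = u" by (auto simp: G_def)
      have ai: "a \<le> i" "i < length w" using ge lt wF by auto
      have "drop a w \<in> nodes (\<lambda>v. S (u @ v)) b"
        using drop_mem_nodes[OF node[OF wF(1)]] ai wF by auto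
      moreover have "Suc (i - a) = length w - a \<or> length w - a = b \<and> i - a \<in> JB u (drop a w)"
      proof (cases "Suc i = length w")
        case True then show ?thesis using ai by auto
      next
        case False
        then have w: "w \<in> leaves S (a + b)" "i \<in> J w" using up[OF wF(1)] by auto
        then show ?thesis using J[OF w(1)] \<phi>[OF w(1)] ai wF by (auto simp: leaves_def)
      qed
      ultimately show "(v, j) \<in> links (\<lambda>v. S (u @ v)) (JB u) b"
        using wi by (auto simp: links_def m_def)
    qed
    moreover have "eulerian ends (m ` G)"
      unfolding eulerian_def
    proof
      fix v
      have 2: "(w, i) \<in> G" if wi: "(w, i) \<in> F" "u @ v \<in> ends (w, i)" for w i
      proof -
        have "take a (u @ v) = u" using lu by simp
        then have "take a w = u \<or> take a (take i w) = u"
          using wi(2) unfolding ends_def by (metis fst_conv insertE singletonD snd_conv)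
        then show ?thesis using wi(1) ge[OF wi(1)] by (auto simp: G_def min_def)
      qed
      have "{e \<in> m ` G. v \<in> ends e} = m ` {e \<in> F. u @ v \<in> ends e}"
      proof -
        have 1: "v \<in> ends (m (w, i)) \<longleftrightarrow> u @ v \<in> ends (w, i)" if wG: "(w, i) \<in> G" for w i
        proof -
          obtain x where x: "w = u @ x" "a \<le> i" using Gw[OF wG] by blast
          then show ?thesis using lu by (auto simp: m_def ends_def)
        qed
        have "{e \<in> m ` G. v \<in> ends e} = m ` {e \<in> G. v \<in> ends (m e)}" by auto
        also have "{e \<in> G. v \<in> ends (m e)} = {e \<in> F. u @ v \<in> ends e}"
        proof -
          have "v \<in> ends (m e) \<longleftrightarrow> u @ v \<in> ends e" if "e \<in> G" for e
            using 1[of "fst e" "snd e"] that by simp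
          moreover have "e \<in> G" if "e \<in> F" "u @ v \<in> ends e" for e
            using 2[of "fst e" "snd e"] that by simp
          moreover have "G \<subseteq> F" by (auto simp: G_def)
          ultimately show ?thesis by blast
        qed
        finally show ?thesis .
      qed
      moreover have "{e \<in> F. u @ v \<in> ends e} \<subseteq> G"
        by (clarify, rule 2)
      ultimately have "card {e \<in> m ` G. v \<in> ends e} = card {e \<in> F. u @ v \<in> ends e}"
        by (simp add: card_image[OF inj_on_subset[OF injm]])
      then show "even (card {e \<in> m ` G. v \<in> ends e})" using F(4) by (simp add: eulerian_def)
    qed
    ultimately have "Suc g \<le> card (m ` G)"
      using B[OF u] finG by (auto simp: eulerian_girth_ge_def)
    also have "\<dots> \<le> card G" using finG(1) by (rule card_image_le)
    also have "\<dots> \<le> card F" using F(2) by (intro card_mono) (auto simp: G_def)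
    finally show ?thesis .
  next
    case False
    define m where "m = (\<lambda>(w :: 'a list, i :: nat). (take a w, i))"
    \<comment> \<open>Contraction is injective: two leaves of a block receive different links, and these end above
      the parent of \<open>u\<close>, so they differ from the parent edge of \<open>u\<close> as well.\<close>
    have injm: "inj_on m out"
    proof (rule inj_onI)
      fix e e' assume *: "e \<in> out" "e' \<in> out" "m e = m e'"
      obtain w i w' where e: "e = (w, i)" "e' = (w', i)" "take a w = take a w'"
        using *(3) by (cases e, cases e') (auto simp: m_def)
      have min: "min (length w) a = min (length w') a" using e(3) by (metis length_take)
      show "e = e'"
      proof (cases "Suc i = length w \<and> length w \<le> a")
        case True
        moreover have "length w' \<le> a"
        proof (rule ccontr)
          assume "\<not> ?thesis"
          then show False
            using outup[of w' i] *(2) e \<phi>[of w'] True min by auto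
        qed
        ultimately show ?thesis using e by simp
      next
        case False
        then have w: "w \<in> leaves S (a + b)" "i = \<phi> w" using outup[of w i] * e by auto
        then have "w' \<in> leaves S (a + b) \<and> i = \<phi> w'"
          using outup[of w' i] * e \<phi>[of w] min by (auto simp: leaves_def)
        then show ?thesis using inj[of w w'] w e by simp
      qed
    qed
    have "m ` out \<subseteq> links S JZ a"
    proof clarify
      fix v j w i assume wi: "(v, j) = m (w, i)" "(w, i) \<in> out"
      have n: "w \<in> nodes S (a + b)" using node wi by (auto simp: out_def)
      then have "take a w \<in> nodes S a" by (auto simp: nodes_def)
      then show "(v, j) \<in> links S JZ a"
        using outup[OF wi(2)] wi(1) \<phi>[of w]
        by (auto simp: links_def m_def leaves_def)
    qed
    moreover have "eulerian ends (m ` out)"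
      unfolding eulerian_def
    proof
      fix z
      have "{e \<in> m ` out. z \<in> ends e} = m ` {e \<in> out. z \<in> ends (m e)}" by auto
      then have card: "card {e \<in> m ` out. z \<in> ends e} = card {e \<in> out. z \<in> ends (m e)}"
        using inj_on_subset[OF injm] by (simp add: card_image)
      consider "length z < a" | "length z = a" | "a < length z" by linarith
      then have "even (card {e \<in> out. z \<in> ends (m e)})"
      proof cases
        case 1
        have "z \<in> ends (m (w, i)) \<longleftrightarrow> z \<in> ends (w, i)" if "(w, i) \<in> out" for w i
          using that 1 by (cases "length w \<le> a") (auto simp: m_def ends_def out_def)
        moreover have "(w, i) \<in> out" if "(w, i) \<in> F" "z \<in> ends (w, i)" for w i
          using that 1 lt[OF that(1)] by (auto simp: ends_def out_def)
        ultimately have "{e \<in> out. z \<in> ends (m e)} = {e \<in> F. z \<in> ends e}"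
          using \<open>out \<subseteq> F\<close> by fast
        then show ?thesis using F(4) by (simp add: eulerian_def)
      next
        case 2
        \<comment> \<open>\<open>z\<close> is a contracted block. The degrees within the block have an even sum, to which an edge
          inside the block contributes two and an edge leaving the block one.\<close>
        define A where "A = {v \<in> \<Union>(ends ` F). take a v = z}"
        have finA: "finite A" using F(2) by (auto simp: A_def ends_def)
        define n where "n = (\<lambda>e. card {v \<in> A. v \<in> ends e})"
        have nA: "n e = card {v \<in> ends e. take a v = z}" if "e \<in> F" for e
          using that unfolding n_def A_def by (intro arg_cong[where f = card]) auto
        have odd: "odd (n (w, i)) \<longleftrightarrow> (w, i) \<in> out \<and> z \<in> ends (m (w, i))"
          if e: "(w, i) \<in> F" for w i
        proof (cases "i < a")
          case True
          have ne: "take i w \<noteq> z" "take a (take i w) \<noteq> z" using True 2 by auto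
          then have "{v \<in> ends (w, i). take a v = z} = (if take a w = z then {w} else {})"
            by (auto simp: ends_def)
          moreover have "z \<in> ends (m (w, i)) \<longleftrightarrow> take a w = z"
            using ne True by (auto simp: ends_def m_def min_def)
          ultimately show ?thesis using True e by (auto simp: nA out_def)
        next
          case False
          then have same: "take a (take i w) = take a w" by (simp add: min_def)
          have "length (take i w) < length w" using lt[OF e] by simp
          then have ne: "w \<noteq> take i w" by (metis less_irrefl)
          have "{v \<in> ends (w, i). take a v = z} =
              (if take a w = z then {w, take i w} else {})"
            using same by (auto simp: ends_def)
          then show ?thesis using False ne by (simp add: nA[OF e] out_def)
        qed
        have "(\<Sum>v\<in>A. card {e \<in> F. v \<in> ends e}) = (\<Sum>e\<in>F. n e)"
          using sum.swap_restrict[OF finA F(2), of "\<lambda>_ _. 1 :: nat" "\<lambda>v e. v \<in> ends e"]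
          by (simp add: n_def)
        moreover have "even (\<Sum>v\<in>A. card {e \<in> F. v \<in> ends e})"
          using F(4) by (intro dvd_sum) (auto simp: eulerian_def)
        ultimately have "even (card {e \<in> F. odd (n e)})"
          using even_sum_iff[OF F(2), of n] by simp
        moreover have "{e \<in> F. odd (n e)} = {e \<in> out. z \<in> ends (m e)}"
        proof -
          have "odd (n e) \<longleftrightarrow> e \<in> out \<and> z \<in> ends (m e)" if "e \<in> F" for e
            using odd[of "fst e" "snd e"] that by simp
          then show ?thesis using \<open>out \<subseteq> F\<close> by blast
        qed
        ultimately show ?thesis by simp
      next
        case 3
        then have "{e \<in> out. z \<in> ends (m e)} = {}"
          by (auto simp: ends_def m_def min_def split: if_splits)
        then show ?thesis by (metis card.empty even_zero)
      qed
      then show "even (card {e \<in> m ` out. z \<in> ends e})" using card by simp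
    qed
    ultimately have "g \<le> card (m ` out)"
      using Z fin False unfolding eulerian_girth_ge_def by (metis finite_imageI image_is_empty)
    then have g: "g \<le> card out" using card_image[OF injm] by simp
    have "inn \<noteq> {}"
    proof
      assume "inn = {}"
      then have "F = out" by (force simp: inn_def out_def)
      moreover have "i = j" if "(w, i) \<in> out" "(w, j) \<in> out" for w i j
        using outup[OF that(1)] outup[OF that(2)] \<open>0 < b\<close> by (auto simp: leaves_def)
      ultimately show False
        using not_eulerian_if_unique_uplinks[OF F(2,3) lt] F(4) by simp
    qed
    then have "0 < card inn" using fin by (simp add: card_gt_0_iff)
    moreover have "card F = card out + card inn"
    proof -
      have "F = out \<union> inn" "out \<inter> inn = {}" by (auto simp: out_def inn_def)
      then show ?thesis using fin by (metis card_Un_disjoint)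
    qed
    ultimately show ?thesis using g by linarith
  qed
qed

text \<open>The links of a leaf \<open>u\<close> of the upper tree that are handed over to the block below \<open>u\<close> can be
  restricted to any sufficiently large subset \<open>X u\<close>; the colour argument selects links of one colour.\<close>

lemma stack_augmentations:
  assumes par: "even a" "even b" and "2 \<le> b"
    and Z: "augments S a JZ M" "eulerian_girth_ge ends (links S JZ a) g"
    and B: "\<And>u. u \<in> leaves S a \<Longrightarrow> augments (\<lambda>v. S (u @ v)) b (JB u) r"
      "\<And>u. u \<in> leaves S a \<Longrightarrow>
         eulerian_girth_ge ends (links (\<lambda>v. S (u @ v)) (JB u) b) (Suc g)"
    and X: "\<And>u. u \<in> leaves S a \<Longrightarrow> X u \<subseteq> JZ u"
      "\<And>u. u \<in> leaves S a \<Longrightarrow> finite (leaves (\<lambda>v. S (u @ v)) b) \<and>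
         card (leaves (\<lambda>v. S (u @ v)) b) \<le> card (X u)"
  obtains J where "augments S (a + b) J (Suc r)"
    and "eulerian_girth_ge ends (links S J (a + b)) (Suc g)"
    and "\<And>w. w \<in> leaves S (a + b) \<Longrightarrow>
      \<exists>i \<in> X (take a w). J w = insert i ((+) a ` JB (take a w) (drop a w))"
proof -
  have "\<exists>\<psi>. \<psi> ` leaves (\<lambda>v. S (u @ v)) b \<subseteq> X u \<and> inj_on \<psi> (leaves (\<lambda>v. S (u @ v)) b)"
    if "u \<in> leaves S a" for u
  proof -
    have "finite (X u)"
      using Z(1) X(1)[OF that] that by (auto simp: augments_def intro: finite_subset)
    then show ?thesis using card_le_inj X(2)[OF that] by blast
  qed
  then obtain \<psi> where \<psi>: "\<And>u. u \<in> leaves S a \<Longrightarrow>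
      \<psi> u ` leaves (\<lambda>v. S (u @ v)) b \<subseteq> X u \<and> inj_on (\<psi> u) (leaves (\<lambda>v. S (u @ v)) b)"
    by metis
  define \<phi> where "\<phi> w = \<psi> (take a w) (drop a w)" for w
  define J where "J w = insert (\<phi> w) ((+) a ` JB (take a w) (drop a w))" for w
  have top: "take a w \<in> leaves S a" if "w \<in> leaves S (a + b)" for w
    using that take_mem_leaves[of w S a b] by (simp add: leaves_def)
  have \<phi>X: "\<phi> w \<in> X (take a w)" if "w \<in> leaves S (a + b)" for w
    using \<psi>[OF top[OF that]] drop_mem_leaves[OF that] by (auto simp: \<phi>_def)
  then have \<phi>: "\<phi> w \<in> JZ (take a w) \<and> Suc (\<phi> w) < a \<and> odd (\<phi> w)"
    if "w \<in> leaves S (a + b)" for w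
    using that X(1)[OF top[OF that]] Z(1) top[OF that] by (auto simp: augments_def)
  have JB: "finite (JB (take a w) (drop a w)) \<and> card (JB (take a w) (drop a w)) = r \<and>
      (\<forall>i \<in> JB (take a w) (drop a w). odd i \<and> Suc i < b)" if "w \<in> leaves S (a + b)" for w
    using B(1)[OF top[OF that]] drop_mem_leaves[OF that] by (simp add: augments_def)
  have aug: "augments S (a + b) J (Suc r)"
    unfolding augments_def
  proof
    fix w assume w: "w \<in> leaves S (a + b)"
    have "\<phi> w \<notin> (+) a ` JB (take a w) (drop a w)" using \<phi>[OF w] by auto
    then have "card (J w) = Suc r"
      using JB[OF w] by (simp add: J_def card_image)
    then show "finite (J w) \<and> card (J w) = Suc r \<and> (\<forall>i \<in> J w. odd i \<and> Suc i < a + b)"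
      using JB[OF w] \<phi>[OF w] par by (auto simp: J_def)
  qed
  have "eulerian_girth_ge ends (links S J (a + b)) (Suc g)"
  proof (rule stack_girth[where \<phi> = \<phi> and JB = JB and JZ = JZ])
    show "0 < b" using assms by simp
    show "J w = insert (\<phi> w) ((+) a ` JB (take a w) (drop a w))" for w by (simp add: J_def)
    show "i < a + b" if "w \<in> leaves S (a + b)" "i \<in> J w" for w i
      using augments_less[OF aug that] .
    show "\<phi> w \<in> JZ (take a w) \<and> Suc (\<phi> w) < a" if "w \<in> leaves S (a + b)" for w
      using \<phi>[OF that] by simp
    show "w = w'" if w: "w \<in> leaves S (a + b)" "w' \<in> leaves S (a + b)"
      and eq: "take a w = take a w'" "\<phi> w = \<phi> w'" for w w'
    proof -
      have "drop a w = drop a w'"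
        using \<psi>[OF top[OF w(1)]] drop_mem_leaves[OF w(1)] drop_mem_leaves[OF w(2)] eq
        by (auto simp: \<phi>_def dest: inj_onD)
      then show ?thesis using eq(1) by (metis append_take_drop_id)
    qed
  qed (use Z B in auto)
  then show ?thesis
  proof (rule that[OF aug])
    show "\<exists>i \<in> X (take a w). J w = insert i ((+) a ` JB (take a w) (drop a w))"
      if "w \<in> leaves S (a + b)" for w
      using \<phi>X[OF that] unfolding J_def by blast
  qed
qed

section \<open>Augmented trees of large girth\<close>

lemma plain_tree_girth: "eulerian_girth_ge ends (links S (\<lambda>_. {}) h) g"
proof -
  have "\<not> eulerian ends F" if F: "F \<subseteq> links S (\<lambda>_. {}) h" "finite F" "F \<noteq> {}" for F
  proof (rule not_eulerian_if_unique_uplinks[OF F(2,3)])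
    have up: "Suc i = length w" if "(w, i) \<in> F" for w i
      using F(1) that by (auto simp: links_def)
    show "i < length w" if "(w, i) \<in> F" for w i using up[OF that] by simp
    show "i = j" if "(w, i) \<in> F" "(w, j) \<in> F" for w i j
      using up[OF that(1)] up[OF that(2)] by simp
  qed
  then show ?thesis unfolding eulerian_girth_ge_def by blast
qed

text \<open>The height must not depend on \<open>S\<close>: it bounds the number of leaves of a block, and so the number
  of links that the upper tree needs has to be known before the blocks below its leaves are chosen.
  The blocks have one link fewer per leaf but already the larger girth, while the upper tree has
  smaller girth but \<open>d ^ b\<close> links per leaf, one for each leaf of a block of height \<open>b\<close>.\<close>

lemma exists_augmentation:
  "\<exists>h. even h \<and> 2 \<le> h \<and> (\<forall>S :: 'a list \<Rightarrow> 'a set. (\<forall>w. finite (S w) \<and> card (S w) \<le> d) \<longrightarrow>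
     (\<exists>J. augments S h J r \<and> eulerian_girth_ge ends (links S J h) g))"
proof (induction g arbitrary: r)
  case 0
  define J where "J = (\<lambda>_ :: 'a list. (\<lambda>j. 2 * j + 1) ` {..<r})"
  have "card (J w) = r" for w
    unfolding J_def by (subst card_image) (auto intro: inj_onI)
  then have "augments S (2 * r + 2) J r" for S
    by (auto simp: augments_def J_def)
  then show ?case by (intro exI[of _ "2 * r + 2"]) (auto simp: eulerian_girth_ge_def)
next
  case (Suc g)
  note outer = Suc.IH
  show ?case
  proof (induction r)
    case 0
    have "augments S 2 (\<lambda>_. {}) 0" for S :: "'a list \<Rightarrow> 'a set" by (simp add: augments_def)
    then show ?case using plain_tree_girth by (intro exI[of _ 2]) fastforce
  next
    case (Suc r)
    then obtain b where b: "even b" "2 \<le> b"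
      and B: "\<And>S :: 'a list \<Rightarrow> 'a set. \<forall>w. finite (S w) \<and> card (S w) \<le> d \<Longrightarrow>
        \<exists>J. augments S b J r \<and> eulerian_girth_ge ends (links S J b) (Suc g)"
      by blast
    obtain a where a: "even a" "2 \<le> a"
      and Z: "\<And>S :: 'a list \<Rightarrow> 'a set. \<forall>w. finite (S w) \<and> card (S w) \<le> d \<Longrightarrow>
        \<exists>J. augments S a J (d ^ b) \<and> eulerian_girth_ge ends (links S J a) g"
      using outer[of "d ^ b"] by blast
    have "\<exists>J. augments S (a + b) J (Suc r) \<and> eulerian_girth_ge ends (links S J (a + b)) (Suc g)"
      if S: "\<forall>w. finite (S w) \<and> card (S w) \<le> d" for S :: "'a list \<Rightarrow> 'a set"
    proof -
      obtain JZ where JZ: "augments S a JZ (d ^ b)" "eulerian_girth_ge ends (links S JZ a) g"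
        using Z[OF S] by blast
      have "\<exists>J. augments (\<lambda>v. S (u @ v)) b J r \<and>
          eulerian_girth_ge ends (links (\<lambda>v. S (u @ v)) J b) (Suc g)" for u
        using S by (intro B) auto
      then obtain JB where JB: "\<And>u. augments (\<lambda>v. S (u @ v)) b (JB u) r"
          "\<And>u. eulerian_girth_ge ends (links (\<lambda>v. S (u @ v)) (JB u) b) (Suc g)"
        by metis
      have "finite (leaves (\<lambda>v. S (u @ v)) b) \<and> card (leaves (\<lambda>v. S (u @ v)) b) \<le> card (JZ u)"
        if "u \<in> leaves S a" for u
        using finite_card_leaves[of "\<lambda>v. S (u @ v)" d b] S JZ(1) that
        by (auto simp: augments_def)
      then show ?thesis
        using stack_augmentations[OF a(1) b JZ JB, of JZ] by (metis order_refl)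
    qed
    then show ?case using a b by (intro exI[of _ "a + b"]) auto
  qed
qed

section \<open>Leaves whose neighbours have distinct letters\<close>

text \<open>\<open>A\<close> is the set of admissible letters. Only the root set \<open>Q\<close> is prescribed, since the root of a
  block must avoid the letter that leads to it, which the block itself does not see.\<close>

definition branching :: "nat \<Rightarrow> 'a set \<Rightarrow> 'a set \<Rightarrow> ('a list \<Rightarrow> 'a set) \<Rightarrow> bool" where
  "branching k Q A S \<longleftrightarrow> S [] = Q \<and>
     (\<forall>w. S w \<subseteq> A \<and> (w \<noteq> [] \<longrightarrow> card (S w) = k - 1 \<and> last w \<notin> S w))"

lemma exists_palette_choice:
  assumes "finite K" "card K = 2 * k - 1" "0 < k"
  obtains P :: "'a set \<Rightarrow> 'a set"
  where "\<And>X. finite X \<Longrightarrow> card X \<le> k \<Longrightarrow> P X \<subseteq> K - X \<and> card (P X) = k - 1"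
proof -
  have "\<exists>Y. Y \<subseteq> K - X \<and> card Y = k - 1" if "finite X" "card X \<le> k" for X
  proof -
    have "k - 1 \<le> card K - card X" using that assms by simp
    also have "\<dots> \<le> card (K - X)" using that by (intro diff_card_le_card_Diff)
    finally show ?thesis by (metis obtain_subset_with_card_n)
  qed
  then show ?thesis using that by metis
qed

text \<open>The set \<open>R\<close> contains the letters of the ancestors above the current block to which its leaves
  are joined. Letters inside the block avoid \<open>R\<close>, so only the links within the block have to be
  compared. As each further link costs one more forbidden letter, \<open>card R + r < k\<close> is preserved by
  the induction, and together with the preceding letter at most \<open>k\<close> letters are ever excluded. The
  position \<open>h - 1\<close> is that of the parent.\<close>

lemma exists_rainbow_augmentation:
  fixes K :: "'a set"
  assumes K: "finite K" "card K = 2 * k - 1" "0 < k"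
  shows "\<exists>h. even h \<and> 2 \<le> h \<and>
    (\<forall>Q R. finite R \<longrightarrow> card R + r < k \<longrightarrow> Q \<subseteq> K - R \<longrightarrow> card Q \<le> k \<longrightarrow>
      (\<exists>S J. branching k Q (K - R) S \<and> augments S h J r \<and>
        eulerian_girth_ge ends (links S J h) (Suc g) \<and>
        (\<forall>w \<in> leaves S h. inj_on ((!) w) (insert (h - 1) (J w)))))"
proof -
  obtain P where P: "\<And>X. finite X \<Longrightarrow> card X \<le> k \<Longrightarrow> P X \<subseteq> K - X \<and> card (P X) = k - 1"
    using exists_palette_choice[OF K] by blast
  define T where "T Q R w = (if w = [] then Q else P (insert (last w) R))" for Q R and w :: "'a list"
  have T: "branching k Q (K - R) (T Q R)"
    if "finite R" "card R < k" "Q \<subseteq> K - R" for Q R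
  proof -
    have "P (insert c R) \<subseteq> K - insert c R \<and> card (P (insert c R)) = k - 1" for c
      using that card_insert_le_m1[of k R c] K(3)
      by (intro P) (auto simp: card_insert_if)
    then show ?thesis using that by (auto simp: branching_def T_def)
  qed
  have degree: "finite (S w) \<and> card (S w) \<le> k"
    if "branching k Q (K - R) S" "card Q \<le> k" for Q R S and w :: "'a list"
    using that K(1) unfolding branching_def
    by (cases "w = []") (auto intro: finite_subset)
  show ?thesis
  proof (induction r)
    case 0
    have "augments S 2 (\<lambda>_. {}) 0" for S :: "'a list \<Rightarrow> 'a set" by (simp add: augments_def)
    then have ok: "branching k Q (K - R) (T Q R) \<and> augments (T Q R) 2 (\<lambda>_. {}) 0 \<and>
        eulerian_girth_ge ends (links (T Q R) (\<lambda>_. {}) 2) (Suc g) \<and>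
        (\<forall>w \<in> leaves (T Q R) 2. inj_on ((!) w) (insert (2 - 1) {}))"
      if "finite R" "card R + 0 < k" "Q \<subseteq> K - R" for Q R
      using T that plain_tree_girth by auto
    show ?case
    proof (intro exI[of _ 2] conjI allI impI)
      fix Q R assume "finite R" "card R + 0 < k" "Q \<subseteq> K - R"
      from ok[OF this]
      show "\<exists>S J. branching k Q (K - R) S \<and> augments S 2 J 0 \<and>
        eulerian_girth_ge ends (links S J 2) (Suc g) \<and>
        (\<forall>w \<in> leaves S 2. inj_on ((!) w) (insert (2 - 1) (J w)))"
        by (intro exI[of _ "T Q R"] exI[of _ "\<lambda>_. {}"])
    qed simp_all
  next
    case (Suc r)
    then obtain b where b: "even b" "2 \<le> b"
      and B: "\<And>Q R. finite R \<Longrightarrow> card R + r < k \<Longrightarrow> Q \<subseteq> K - R \<Longrightarrow> card Q \<le> k \<Longrightarrow>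
      (\<exists>S J. branching k Q (K - R) S \<and> augments S b J r \<and>
        eulerian_girth_ge ends (links S J b) (Suc g) \<and>
        (\<forall>w \<in> leaves S b. inj_on ((!) w) (insert (b - 1) (J w))))"
      by blast
    obtain a where a: "even a" "2 \<le> a"
      and Z: "\<And>S :: 'a list \<Rightarrow> 'a set. \<forall>w. finite (S w) \<and> card (S w) \<le> k \<Longrightarrow>
        \<exists>J. augments S a J (card K * k ^ b) \<and> eulerian_girth_ge ends (links S J a) g"
      using exists_augmentation[of k "card K * k ^ b" g] by blast
    have step: "\<exists>S J. branching k Q (K - R) S \<and> augments S (a + b) J (Suc r) \<and>
        eulerian_girth_ge ends (links S J (a + b)) (Suc g) \<and>
        (\<forall>w \<in> leaves S (a + b). inj_on ((!) w) (insert (a + b - 1) (J w)))"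
      if R: "finite R" "card R + Suc r < k" and Q: "Q \<subseteq> K - R" "card Q \<le> k" for Q R
    proof -
      have TQ: "branching k Q (K - R) (T Q R)" using T R Q by simp
      obtain JZ where JZ: "augments (T Q R) a JZ (card K * k ^ b)"
          "eulerian_girth_ge ends (links (T Q R) JZ a) g"
        using Z[of "T Q R"] degree[OF TQ Q(2)] by blast
      \<comment> \<open>The word \<open>u\<close> is known before its block is built, so a frequent letter among those at its
        links can be selected and then forbidden in the block.\<close>
      have "\<exists>c. k ^ b \<le> card {i \<in> JZ u. u ! i = c}" if u: "u \<in> leaves (T Q R) a" for u
      proof -
        have J: "finite (JZ u)" "card (JZ u) = card K * k ^ b" "\<And>i. i \<in> JZ u \<Longrightarrow> Suc i < a"
          using JZ(1) u by (auto simp: augments_def)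
        have "(!) u \<in> JZ u \<rightarrow> K"
        proof
          fix i assume "i \<in> JZ u"
          then have "u ! i \<in> T Q R (take i u)"
            using u J(3)[of i] by (auto simp: leaves_def nodes_def)
          then show "u ! i \<in> K" using TQ by (auto simp: branching_def)
        qed
        moreover have "0 < card K" using K by simp
        then have "K \<noteq> {}" by auto
        ultimately obtain c where "card ((!) u -` {c} \<inter> JZ u) * card K \<ge> card K * k ^ b"
          using pigeonhole_card[of "(!) u" "JZ u" K] J K by auto
        moreover have "(!) u -` {c} \<inter> JZ u = {i \<in> JZ u. u ! i = c}" by auto
        ultimately show ?thesis using \<open>0 < card K\<close> by (auto simp: mult.commute)
      qed
      then obtain c where c: "\<And>u. u \<in> leaves (T Q R) a \<Longrightarrow> k ^ b \<le> card {i \<in> JZ u. u ! i = c u}"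
        by metis
      define R' where "R' u = insert (c u) R" for u
      define Q' where "Q' u = P (insert (last u) (R' u))" for u
      have R': "finite (R' u)" "card (R' u) + r < k" for u
        using R by (auto simp: R'_def card_insert_if)
      have Q': "Q' u \<subseteq> K - insert (last u) (R' u) \<and> card (Q' u) = k - 1" for u
        unfolding Q'_def using R R' [of u] by (intro P) (auto simp: card_insert_if)
      have "\<exists>S J. branching k (Q' u) (K - R' u) S \<and> augments S b J r \<and>
        eulerian_girth_ge ends (links S J b) (Suc g) \<and>
        (\<forall>w \<in> leaves S b. inj_on ((!) w) (insert (b - 1) (J w)))" for u
        using Q'[of u] by (intro B R') auto
      then obtain SB JB where SB: "\<And>u. branching k (Q' u) (K - R' u) (SB u)"
        and JB: "\<And>u. augments (SB u) b (JB u) r"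
          "\<And>u. eulerian_girth_ge ends (links (SB u) (JB u) b) (Suc g)"
        and rainbow: "\<And>u w. w \<in> leaves (SB u) b \<Longrightarrow> inj_on ((!) w) (insert (b - 1) (JB u w))"
        by metis
      define S where "S w = (if length w < a then T Q R w else SB (take a w) (drop a w))" for w
      have leafS: "leaves S a = leaves (T Q R) a"
        using nodes_cong[of a S "T Q R"] by (simp add: S_def leaves_def)
      have SBu: "(\<lambda>v. S (u @ v)) = SB u" if "u \<in> leaves S a" for u
        using that by (auto simp: S_def leaves_def)
      have S: "branching k Q (K - R) S"
        unfolding branching_def
      proof (intro conjI allI impI)
        show "S [] = Q" using TQ a by (simp add: S_def branching_def)
        fix w
        show "S w \<subseteq> K - R"
          using TQ SB[of "take a w"] by (auto simp: S_def branching_def R'_def)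
        assume "w \<noteq> []"
        consider "length w < a" | "length w = a" | "a < length w" by linarith
        then have "card (S w) = k - 1 \<and> last w \<notin> S w"
        proof cases
          case 1 then show ?thesis using TQ \<open>w \<noteq> []\<close> by (simp add: S_def branching_def)
        next
          case 2
          then have "S w = Q' w" using SB[of w] by (simp add: S_def branching_def)
          then show ?thesis using Q'[of w] by auto
        next
          case 3
          then have "last (drop a w) = last w" "drop a w \<noteq> []" by auto
          then show ?thesis using SB[of "take a w"] 3 unfolding S_def branching_def
            by (metis less_imp_not_less)
        qed
        then show "card (S w) = k - 1" "last w \<notin> S w" by auto
      qed
      define X where "X u = {i \<in> JZ u. u ! i = c u}" for u
      have Xcard: "finite (leaves (\<lambda>v. S (u @ v)) b) \<and>
          card (leaves (\<lambda>v. S (u @ v)) b) \<le> card (X u)" if u: "u \<in> leaves S a" for u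
      proof -
        have "finite (leaves (SB u) b) \<and> card (leaves (SB u) b) \<le> k ^ b"
          using Q'[of u] by (intro finite_card_leaves degree[OF SB]) auto
        then show ?thesis
          using c[of u] u unfolding SBu[OF u] leafS X_def by linarith
      qed
      have "augments S a JZ (card K * k ^ b)"
        using JZ(1) by (simp add: augments_def leafS)
      moreover have "eulerian_girth_ge ends (links S JZ a) g"
        using JZ(2) links_cong[of a S "T Q R" JZ] by (simp add: S_def)
      moreover have "augments (\<lambda>v. S (u @ v)) b (JB u) r"
        "eulerian_girth_ge ends (links (\<lambda>v. S (u @ v)) (JB u) b) (Suc g)"
        if "u \<in> leaves S a" for u
        using JB[of u] SBu[OF that] by auto
      moreover have "X u \<subseteq> JZ u" for u by (auto simp: X_def)
      ultimately obtain J where J: "augments S (a + b) J (Suc r)"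
          "eulerian_girth_ge ends (links S J (a + b)) (Suc g)"
        and Jw: "\<And>w. w \<in> leaves S (a + b) \<Longrightarrow>
          \<exists>i \<in> X (take a w). J w = insert i ((+) a ` JB (take a w) (drop a w))"
        using Xcard by (rule stack_augmentations[OF a(1) b]) blast+
      have "inj_on ((!) w) (insert (a + b - 1) (J w))" if w: "w \<in> leaves S (a + b)" for w
      proof -
        define u v where "u = take a w" and "v = drop a w"
        have lw: "length w = a + b" using w by (simp add: leaves_def)
        have u: "u \<in> leaves S a"
          using w take_mem_leaves[of w S a b] by (simp add: leaves_def u_def)
        have v: "v \<in> leaves (SB u) b"
          using drop_mem_leaves[OF w] SBu[OF u] by (simp add: u_def v_def)
        obtain i where i: "i \<in> X u" and Ji: "J w = insert i ((+) a ` JB u v)"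
          using Jw[OF w] by (auto simp: u_def v_def)
        define I where "I = insert (b - 1) (JB u v)"
        have I: "j < b" if "j \<in> I" for j
          using that augments_less[OF JB(1) v] b by (auto simp: I_def)
        have block: "w ! (a + j) = v ! j" for j using lw by (simp add: v_def)
        have "i < a" using i u augments_less[OF JZ(1)] by (auto simp: X_def leafS)
        then have "w ! i = c u" using i by (simp add: X_def u_def)
        moreover have "v ! j \<noteq> c u" if "j \<in> I" for j
          using v I[OF that] SB[of u]
          by (auto simp: leaves_def nodes_def branching_def R'_def)
        ultimately have "w ! i \<notin> (!) v ` I" by (metis imageE)
        then have "w ! i \<notin> (!) w ` (+) a ` I" by (simp add: image_image block)
        moreover have "inj_on ((!) w) ((+) a ` I)"
          using rainbow[OF v] by (auto simp: inj_on_def block I_def)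
        moreover have "insert (a + b - 1) (J w) = insert i ((+) a ` I)"
          using b by (auto simp: Ji I_def)
        ultimately show ?thesis by auto
      qed
      then show ?thesis by (intro exI[of _ S] exI[of _ J] conjI ballI S J)
    qed
    show ?case
    proof (rule exI[of _ "a + b"], intro conjI allI impI)
      show "even (a + b)" "2 \<le> a + b" using a b by simp_all
    qed (rule step)
  qed
qed

section \<open>Lists without a proper choice of colours\<close>

definition colour_list ::
  "('a list \<Rightarrow> 'a set) \<Rightarrow> ('a list \<Rightarrow> nat set) \<Rightarrow> nat \<Rightarrow> 'a list \<Rightarrow> 'a set" where
  "colour_list S J h w =
     (if length w = h then (!) w ` insert (h - 1) (J w)
      else if w = [] then S [] else insert (last w) (S w))"

lemma colour_list_card:
  assumes S: "branching k Q K S" "card Q = k" "finite K" and J: "augments S h J (k - 1)"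
    and rainbow: "\<And>w. w \<in> leaves S h \<Longrightarrow> inj_on ((!) w) (insert (h - 1) (J w))"
    and "0 < k" "0 < h" and w: "w \<in> nodes S h"
  shows "colour_list S J h w \<subseteq> K \<and> card (colour_list S J h w) = k"
proof -
  have letter: "w ! i \<in> K" if "i < length w" for i
    using S(1) w that by (auto simp: branching_def nodes_def)
  show ?thesis
  proof (cases "length w = h")
    case True
    then have leaf: "w \<in> leaves S h" using w by (simp add: leaves_def)
    have "h - 1 \<in> J w \<Longrightarrow> Suc (h - 1) < h" using J leaf unfolding augments_def by blast
    then have "h - 1 \<notin> J w" by linarith
    then have "card (insert (h - 1) (J w)) = k"
      using J leaf \<open>0 < k\<close> by (simp add: augments_def)
    then show ?thesis
      using True letter augments_less[OF J leaf] \<open>0 < h\<close> card_image[OF rainbow[OF leaf]]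
      by (auto simp: colour_list_def)
  next
    case False
    show ?thesis
    proof (cases "w = []")
      case True
      then show ?thesis using S False by (auto simp: colour_list_def branching_def)
    next
      case ne: False
      then have "last w \<in> K" using letter[of "length w - 1"] by (simp add: last_conv_nth)
      moreover have "S w \<subseteq> K" "card (S w) = k - 1" "last w \<notin> S w"
        using S(1) ne by (auto simp: branching_def)
      moreover have "finite (S w)" using \<open>S w \<subseteq> K\<close> S(3) by (rule finite_subset)
      ultimately show ?thesis using False ne \<open>0 < k\<close> by (auto simp: colour_list_def)
    qed
  qed
qed

text \<open>Following the chosen colours from the root leads to a leaf whose word spells out the colours of its
  ancestors; its list consists of the colours of its neighbours.\<close>

lemma no_proper_choice:
  assumes J: "augments S h J r" and "0 < h"
    and f: "\<And>w. w \<in> nodes S h \<Longrightarrow> f w \<in> colour_list S J h w"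
    and proper: "\<And>w i. (w, i) \<in> links S J h \<Longrightarrow> f w \<noteq> f (take i w)"
  shows False
proof -
  have walk: "\<exists>w \<in> leaves S n. \<forall>i<n. f (take i w) = w ! i" if "n \<le> h" for n
    using that
  proof (induction n)
    case 0
    then show ?case by (auto simp: leaves_def nodes_def)
  next
    case (Suc n)
    then obtain w where w: "w \<in> leaves S n" "\<forall>i<n. f (take i w) = w ! i" by auto
    then have len: "length w = n" and node: "w \<in> nodes S h"
      using Suc.prems by (auto simp: leaves_def nodes_def)
    have "f w \<in> S w"
    proof (cases "w = []")
      case True
      then show ?thesis using f[OF node] Suc.prems len by (simp add: colour_list_def)
    next
      case False
      then have "(w, n - 1) \<in> links S J h" using node len by (auto simp: links_def)
      then have "f w \<noteq> f (take (n - 1) w)" by (rule proper)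
      moreover have "f (take (n - 1) w) = last w"
        using w(2) False len by (cases n) (auto simp: last_conv_nth)
      ultimately show ?thesis
        using f[OF node] Suc.prems len False by (simp add: colour_list_def)
    qed
    then have "w @ [f w] \<in> leaves S (Suc n)"
      using w len by (auto simp: leaves_def nodes_def nth_append less_Suc_eq)
    then show ?case
      using w len by (intro bexI[of _ "w @ [f w]"]) (auto simp: nth_append less_Suc_eq)
  qed
  then obtain w where w: "w \<in> leaves S h" "\<And>i. i < h \<Longrightarrow> f (take i w) = w ! i" by blast
  then have node: "w \<in> nodes S h" "length w = h" by (auto simp: leaves_def)
  obtain i where i: "i \<in> insert (h - 1) (J w)" "f w = w ! i"
    using f[OF node(1)] node(2) by (auto simp: colour_list_def)
  have "i < h" using i(1) augments_less[OF J w(1)] \<open>0 < h\<close> by auto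
  moreover have "(w, i) \<in> links S J h" using i(1) node \<open>0 < h\<close> by (auto simp: links_def)
  ultimately show False using proper w(2) i(2) by metis
qed

text \<open>Fewer colours can be split into two sets of at most \<open>k - 1\<close> colours. Each list meets both, so
  colours for the two sides of the bipartition can be taken from different sets.\<close>

lemma many_colours_if_not_list_colorable:
  assumes "bipartite V E" "list_assignment k V L" "\<not> list_colorable V E L"
    and fin: "finite (\<Union>v\<in>V. L v)" and "0 < k"
  shows "2 * k - 1 \<le> card (\<Union>v\<in>V. L v)"
proof (rule ccontr)
  let ?U = "\<Union>v\<in>V. L v"
  assume "\<not> ?thesis"
  then have U: "card ?U \<le> 2 * (k - 1)" by simp
  obtain X where X: "X \<subseteq> ?U" "card X = min (k - 1) (card ?U)"
    by (meson min.cobounded2 obtain_subset_with_card_n)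
  have finX: "finite X" using X(1) fin by (rule finite_subset)
  have "card (?U - X) = card ?U - card X" using X finX by (simp add: card_Diff_subset)
  then have small: "card X < k" "card (?U - X) < k" using X(2) U \<open>0 < k\<close> by auto
  have L: "card (L v) = k" "L v \<subseteq> ?U" if "v \<in> V" for v
    using that assms(2) by (auto simp: list_assignment_def)
  have meets: "\<exists>c. c \<in> L v \<and> (c \<in> X \<longleftrightarrow> v \<in> A)" if "v \<in> V" for v A
  proof -
    have "\<not> L v \<subseteq> X" "\<not> L v \<subseteq> ?U - X"
      using L[OF that] small card_mono[OF finX, of "L v"] card_mono[of "?U - X" "L v"] fin
      by (auto simp del: UN_simps)
    then show ?thesis using L(2)[OF that] by blast
  qed
  obtain A B where AB: "A \<union> B = V" "A \<inter> B = {}" "\<forall>e\<in>E. \<exists>a\<in>A. \<exists>b\<in>B. e = {a, b}"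
    using assms(1) by (auto simp: bipartite_def)
  obtain f where f: "\<And>v. v \<in> V \<Longrightarrow> f v \<in> L v \<and> (f v \<in> X \<longleftrightarrow> v \<in> A)"
    using meets[where A = A] by metis
  have "proper_coloring V E f"
    unfolding proper_coloring_def
  proof (intro ballI impI)
    fix u v assume "u \<in> V" "v \<in> V" "{u, v} \<in> E"
    then obtain a b where "a \<in> A" "b \<in> B" "{u, v} = {a, b}" using AB(3) by blast
    then have "u \<in> A \<longleftrightarrow> v \<notin> A" using AB(2) by (auto simp: doubleton_eq_iff)
    then show "f u \<noteq> f v" using f \<open>u \<in> V\<close> \<open>v \<in> V\<close> by metis
  qed
  then show False using f assms(3) by (auto simp: list_colorable_def)
qed

section \<open>Sparseness of proper subgraphs\<close>

definition owned ::
  "('a list \<Rightarrow> 'a set) \<Rightarrow> ('a list \<Rightarrow> nat set) \<Rightarrow> nat \<Rightarrow> 'a list \<Rightarrow> ('a list \<times> nat) set" where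
  "owned S J h w =
     (if length w = h then Pair w ` J w else (\<lambda>c. (w @ [c], length w)) ` S w)"

lemma link_owned_by_end:
  assumes "e \<in> links S J h"
  shows "\<exists>w \<in> ends e. w \<in> nodes S h \<and> e \<in> owned S J h w"
proof -
  obtain w i where e: "e = (w, i)" by (cases e)
  have w: "w \<in> nodes S h" using assms e by (simp add: links_def)
  show ?thesis
  proof (cases "length w = h \<and> i \<in> J w")
    case True
    then show ?thesis using e w by (auto simp: ends_def owned_def)
  next
    case False
    then have i: "Suc i = length w" using assms e by (auto simp: links_def)
    then have "w = take i w @ [w ! i]" by (metis lessI take_Suc_conv_app_nth take_all_iff order_refl)
    moreover have "w ! i \<in> S (take i w)" "length (take i w) \<noteq> h" "length (take i w) = i"
      using w i by (auto simp: nodes_def)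
    ultimately have "e \<in> owned S J h (take i w)" using e by (auto simp: owned_def)
    then show ?thesis using e take_mem_nodes[OF w] by (auto simp: ends_def)
  qed
qed

text \<open>Counting edges at their owners gives the bound with an excess of one when the root is present.
  If this excess were attained, all edges owned in \<open>W\<close> would belong to \<open>F\<close>; then \<open>W\<close> is closed under passing to
  children, so it contains all vertices.\<close>

lemma proper_part_sparse:
  assumes S: "branching k Q K S" "card Q = k" "finite K" and J: "augments S h J (k - 1)"
    and "0 < k" "0 < h"
    and W: "W \<subseteq> nodes S h" and F: "F \<subseteq> links S J h" "\<And>e. e \<in> F \<Longrightarrow> ends e \<subseteq> W"
    and proper: "(W, F) \<noteq> (nodes S h, links S J h)"
  shows "card F \<le> (k - 1) * card W"
proof -
  have finS: "finite (S w)" for w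
    using S by (auto simp: branching_def intro: finite_subset)
  have finW: "finite W" using finite_subset[OF W finite_nodes] finS by blast
  have fin: "finite (owned S J h w)" if "w \<in> W" for w
    using that W J finS by (auto simp: owned_def augments_def leaves_def)
  have card_owned: "card (owned S J h w) = (k - 1) + (if w = [] then 1 else 0)" if "w \<in> W" for w
  proof (cases "length w = h")
    case True
    then have "w \<in> leaves S h" using that W by (auto simp: leaves_def)
    then have "card (J w) = k - 1" using J by (simp add: augments_def)
    then show ?thesis
      using True \<open>0 < h\<close> by (auto simp: owned_def card_image inj_on_def)
  next
    case False
    have "card (owned S J h w) = card (S w)"
      using False by (simp add: owned_def card_image inj_on_def)
    then show ?thesis using S(1,2) \<open>0 < k\<close> by (auto simp: branching_def)
  qed
  let ?O = "\<Union>(owned S J h ` W)"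
  have FO: "F \<subseteq> ?O"
  proof
    fix e assume e: "e \<in> F"
    then obtain w where "w \<in> ends e" "e \<in> owned S J h w"
      using F(1) link_owned_by_end[of e S J h] by blast
    then show "e \<in> ?O" using F(2)[OF e] by blast
  qed
  have finO: "finite ?O" using finW fin by blast
  have "card ?O \<le> (\<Sum>w\<in>W. card (owned S J h w))" by (rule card_UN_le[OF finW])
  also have "\<dots> = (k - 1) * card W + (if [] \<in> W then 1 else 0)"
    using finW by (simp add: card_owned sum.distrib)
  finally have O: "card ?O \<le> (k - 1) * card W + (if [] \<in> W then 1 else 0)" .
  show ?thesis
  proof (cases "[] \<in> W")
    case False
    then show ?thesis using O card_mono[OF finO FO] by simp
  next
    case True
    have "F \<noteq> ?O"
    proof
      assume FO': "F = ?O"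
      have prefix: "take i w \<in> W" if w: "w \<in> nodes S h" and "i \<le> length w" for w i
        using that(2)
      proof (induction i)
        case 0
        then show ?case using True by simp
      next
        case (Suc i)
        then have "take i w \<in> W" "length (take i w) = i" "i < h" "w ! i \<in> S (take i w)"
          using w by (auto simp: nodes_def)
        then have "(take (Suc i) w, i) \<in> owned S J h (take i w)"
          using Suc.prems by (auto simp: owned_def take_Suc_conv_app_nth)
        then have "(take (Suc i) w, i) \<in> F" using FO' \<open>take i w \<in> W\<close> by blast
        then show ?case using F(2) by (auto simp: ends_def)
      qed
      have "nodes S h \<subseteq> W"
      proof
        fix w assume "w \<in> nodes S h"
        then show "w \<in> W" using prefix[of w "length w"] by simp
      qed
      then have "W = nodes S h" using W by blast
      moreover have "links S J h \<subseteq> F"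
      proof
        fix e assume "e \<in> links S J h"
        then obtain w where "w \<in> nodes S h" "e \<in> owned S J h w"
          using link_owned_by_end by blast
        then show "e \<in> F" unfolding FO' using \<open>W = nodes S h\<close> by blast
      qed
      then have "F = links S J h" using F(1) by blast
      ultimately show False using proper by simp
    qed
    then have "card F < card ?O" using FO by (intro psubset_card_mono finO) auto
    then show ?thesis using O by (simp split: if_splits)
  qed
qed

section \<open>The graph\<close>

theorem theorem3p8:
  fixes k g :: nat
  assumes "1 \<le> g" and "even g" and "2 \<le> k"
  shows "\<exists>(V :: nat set) (E :: nat set set) (L :: nat \<Rightarrow> nat set).
           fin_simple_graph V E \<and> bipartite V E \<and> list_assignment k V L \<and>
           \<not> list_colorable V E L \<and>
           card (\<Union>v\<in>V. L v) = 2 * k - 1 \<and>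
           enat g \<le> girth V E \<and>
           (\<forall>V' E'. proper_subgraph V' E' V E \<longrightarrow> average_degree V' E' \<le> 2 * (real k - 1))"
proof -
  define K where "K = {..<2 * k - 1}"
  define Q where "Q = {..<k}"
  have K: "finite K" "card K = 2 * k - 1" "0 < k" using assms by (auto simp: K_def)
  have Q: "Q \<subseteq> K - {}" "card Q = k" using assms by (auto simp: K_def Q_def)
  obtain h where h: "even h" "2 \<le> h" and
    ex: "\<And>Q R. finite R \<Longrightarrow> card R + (k - 1) < k \<Longrightarrow> Q \<subseteq> K - R \<Longrightarrow> card Q \<le> k \<Longrightarrow>
      (\<exists>S J. branching k Q (K - R) S \<and> augments S h J (k - 1) \<and>
        eulerian_girth_ge ends (links S J h) (Suc g) \<and>
        (\<forall>w \<in> leaves S h. inj_on ((!) w) (insert (h - 1) (J w))))"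
    using exists_rainbow_augmentation[OF K, of "k - 1" g] by blast
  obtain S J where S: "branching k Q K S" and J: "augments S h J (k - 1)"
    and girth: "eulerian_girth_ge ends (links S J h) (Suc g)"
    and rainbow: "\<And>w. w \<in> leaves S h \<Longrightarrow> inj_on ((!) w) (insert (h - 1) (J w))"
    using ex[of "{}" Q] Q K(3) by auto
  have h0: "0 < h" using h by simp
  have finS: "finite (S w)" for w
    using S K(1) by (auto simp: branching_def intro: finite_subset)
  define N where "N = nodes S h"
  define M where "M = links S J h"
  have finN: "finite N" unfolding N_def by (intro finite_nodes finS)
  have link: "w \<in> N \<and> take i w \<in> N \<and> i < length w \<and> (even i \<longleftrightarrow> odd (length w))"
    if "(w, i) \<in> M" for w i
  proof -
    have w: "w \<in> N" using that by (simp add: M_def N_def links_def)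
    have "Suc i = length w \<or> w \<in> leaves S h \<and> i \<in> J w"
      using that by (auto simp: M_def links_def leaves_def)
    then show ?thesis
    proof
      assume "Suc i = length w"
      then have "i < length w" "even i \<longleftrightarrow> odd (length w)" by (auto simp flip: \<open>Suc i = length w\<close>)
      then show ?thesis using w take_mem_nodes by (auto simp: N_def)
    next
      assume *: "w \<in> leaves S h \<and> i \<in> J w"
      then have "i < h" "odd i" "length w = h"
        using augments_less[OF J] J by (auto simp: augments_def leaves_def)
      then show ?thesis using w h take_mem_nodes by (auto simp: N_def)
    qed
  qed
  define img where "img e = list_encode ` ends e" for e
  define V where "V = list_encode ` N"
  define E where "E = img ` M"
  define L where "L v = colour_list S J h (list_decode v)" for v
  have img: "img (w, i) = {list_encode w, list_encode (take i w)}" for w i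
    by (simp add: img_def ends_def)
  have mem_img: "list_encode v \<in> img e \<longleftrightarrow> v \<in> ends e" for v e
    unfolding img_def by (rule inj_image_mem_iff[OF inj_list_encode])
  have inj: "inj_on img M"
  proof (rule inj_onI)
    fix e e' assume *: "e \<in> M" "e' \<in> M" "img e = img e'"
    obtain w i w' i' where e: "e = (w, i)" "e' = (w', i')" by (cases e, cases e')
    have "ends e = ends e'"
      using *(3) inj_image_eq_iff[OF inj_list_encode] unfolding img_def by blast
    then have "w = w' \<and> take i w = take i' w' \<or> w = take i' w' \<and> take i w = w'"
      using e by (auto simp: ends_def doubleton_eq_iff)
    moreover have len: "length (take i w) = i" "length (take i' w') = i'" "i < length w" "i' < length w'"
      using link[of w i] link[of w' i'] * e by auto
    ultimately show "e = e'" using e by (metis order_less_asym)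
  qed
  have simple: "fin_simple_graph V E"
  proof -
    have "img e \<subseteq> V \<and> card (img e) = 2" if "e \<in> M" for e
    proof -
      obtain w i where e: "e = (w, i)" by (cases e)
      have "length (take i w) \<noteq> length w" using link[of w i] that e by auto
      then have "list_encode w \<noteq> list_encode (take i w)" by (metis list_encode_eq)
      then have "card (img e) = 2" unfolding e img by (rule card_2_iff[THEN iffD2, OF exI, OF exI, OF conjI, OF refl])
      then show ?thesis using link[of w i] that e by (simp add: img V_def)
    qed
    then show ?thesis using finN by (auto simp: fin_simple_graph_def V_def E_def)
  qed
  have bip: "bipartite V E"
    unfolding bipartite_def
  proof (intro exI conjI)
    let ?A = "list_encode ` {w \<in> N. even (length w)}" and ?B = "list_encode ` {w \<in> N. odd (length w)}"
    show "?A \<union> ?B = V" "?A \<inter> ?B = {}" by (auto simp: V_def list_encode_eq)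
    show "\<forall>e\<in>E. \<exists>a\<in>?A. \<exists>b\<in>?B. e = {a, b}"
    proof
      fix x assume "x \<in> E"
      then obtain w i where wi: "(w, i) \<in> M" "x = {list_encode w, list_encode (take i w)}"
        by (auto simp: E_def img)
      have l: "w \<in> N" "take i w \<in> N" "length (take i w) = i" "even i \<longleftrightarrow> odd (length w)"
        using link[OF wi(1)] by auto
      show "\<exists>a\<in>?A. \<exists>b\<in>?B. x = {a, b}"
      proof (cases "even (length w)")
        case True
        then have "list_encode w \<in> ?A" "list_encode (take i w) \<in> ?B" using l by auto
        then show ?thesis using wi(2) by (intro bexI)
      next
        case False
        then have "list_encode (take i w) \<in> ?A" "list_encode w \<in> ?B" using l by auto
        moreover have "x = {list_encode (take i w), list_encode w}"
          using wi(2) by (simp add: insert_commute)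
        ultimately show ?thesis by (intro bexI)
      qed
    qed
  qed
  have lists: "L v \<subseteq> K \<and> card (L v) = k" if v: "v \<in> V" for v
  proof -
    obtain w where w: "w \<in> nodes S h" "v = list_encode w" using v by (auto simp: V_def N_def)
    show ?thesis
      using colour_list_card[OF S Q(2) K(1) J rainbow K(3) h0 w(1)] w(2) by (simp add: L_def)
  qed
  then have assignment: "list_assignment k V L"
    using K(1) by (auto simp: list_assignment_def intro: finite_subset)
  have uncolourable: "\<not> list_colorable V E L"
  proof
    assume "list_colorable V E L"
    then obtain f where f: "proper_coloring V E f" "\<And>v. v \<in> V \<Longrightarrow> f v \<in> L v"
      by (auto simp: list_colorable_def)
    show False
    proof (rule no_proper_choice[OF J h0])
      show "(f \<circ> list_encode) w \<in> colour_list S J h w" if "w \<in> nodes S h" for w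
        using f(2)[of "list_encode w"] that by (auto simp: V_def N_def L_def)
      show "(f \<circ> list_encode) w \<noteq> (f \<circ> list_encode) (take i w)" if "(w, i) \<in> links S J h" for w i
      proof -
        have "img (w, i) \<in> E" using that by (simp add: E_def M_def)
        moreover have "w \<in> N" "take i w \<in> N" using link[of w i] that by (auto simp: M_def)
        ultimately show ?thesis using f(1) by (auto simp: proper_coloring_def img V_def)
      qed
    qed
  qed
  have "(\<Union>v\<in>V. L v) \<subseteq> K" using lists by blast
  then have "finite (\<Union>v\<in>V. L v)" "card (\<Union>v\<in>V. L v) \<le> 2 * k - 1"
    using K card_mono[OF K(1)] finite_subset by auto
  then have colours: "card (\<Union>v\<in>V. L v) = 2 * k - 1"
    using many_colours_if_not_list_colorable[OF bip assignment uncolourable _ K(3)] by simp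
  have "eulerian_girth_ge (\<lambda>e. e) E g"
    unfolding eulerian_girth_ge_def
  proof (intro allI impI)
    fix F assume F: "F \<subseteq> E" "finite F" "F \<noteq> {}" "eulerian (\<lambda>e. e) F"
    define G where "G = {e \<in> M. img e \<in> F}"
    have G: "img ` G = F" using F(1) by (auto simp: G_def E_def)
    have injG: "inj_on img G" by (rule inj_on_subset[OF inj]) (auto simp: G_def)
    have "even (card {e \<in> G. v \<in> ends e})" for v
    proof -
      have "img ` {e \<in> G. v \<in> ends e} = {x \<in> F. list_encode v \<in> x}"
        using G mem_img by blast
      moreover have "inj_on img {e \<in> G. v \<in> ends e}" by (rule inj_on_subset[OF injG]) auto
      ultimately have "card {e \<in> G. v \<in> ends e} = card {x \<in> F. list_encode v \<in> x}"
        using card_image[of img "{e \<in> G. v \<in> ends e}"] by simp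
      then show ?thesis using F(4) by (simp add: eulerian_def)
    qed
    then have "eulerian ends G" by (simp add: eulerian_def)
    moreover have "finite G" using F(2) G finite_image_iff[OF injG] by simp
    moreover have "G \<noteq> {}" using F(3) G by auto
    moreover have "G \<subseteq> links S J h" by (auto simp: G_def M_def)
    ultimately have "Suc g \<le> card G" using girth by (auto simp: eulerian_girth_ge_def)
    then show "g \<le> card F" using card_image[OF injG] G by simp
  qed
  then have girth_ge: "enat g \<le> girth V E" by (rule girth_ge_if_eulerian)
  have "average_degree V' E' \<le> 2 * (real k - 1)" if sub: "proper_subgraph V' E' V E" for V' E'
  proof -
    have V': "V' \<subseteq> V" "V' \<noteq> {}" "finite V'" and E': "E' \<subseteq> E" "\<And>e. e \<in> E' \<Longrightarrow> e \<subseteq> V'"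
      and ne: "(V', E') \<noteq> (V, E)"
      using sub by (auto simp: proper_subgraph_def subgraph_def fin_simple_graph_def)
    define W where "W = {w \<in> N. list_encode w \<in> V'}"
    define F where "F = {e \<in> M. img e \<in> E'}"
    have WV: "list_encode ` W = V'" using V'(1) by (auto simp: W_def V_def)
    have FE: "img ` F = E'" using E'(1) by (auto simp: F_def E_def)
    have cards: "card V' = card W" "card E' = card F"
      using card_image[OF inj_list_encode, of W] card_image[OF inj_on_subset[OF inj], of F] WV FE
      by (auto simp: F_def)
    have "card F \<le> (k - 1) * card W"
    proof (rule proper_part_sparse[OF S Q(2) K(1) J K(3) h0])
      show "W \<subseteq> nodes S h" "F \<subseteq> links S J h" by (auto simp: W_def F_def N_def M_def)
      show "ends e \<subseteq> W" if "e \<in> F" for e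
      proof -
        obtain w i where e: "e = (w, i)" by (cases e)
        have "(w, i) \<in> M" "img (w, i) \<subseteq> V'" using that E'(2) e by (auto simp: F_def)
        then show ?thesis using link[of w i] e by (auto simp: W_def ends_def img)
      qed
      show "(W, F) \<noteq> (nodes S h, links S J h)"
        using ne WV FE by (auto simp: V_def E_def N_def M_def)
    qed
    then have "real (card E') \<le> real (k - 1) * real (card V')"
      unfolding cards by (metis of_nat_le_iff of_nat_mult)
    moreover have "0 < real (card V')" using V' by (simp add: card_gt_0_iff)
    moreover have "real (k - 1) = real k - 1" using K(3) by (simp add: of_nat_diff)
    ultimately have "2 * real (card E') \<le> 2 * ((real k - 1) * real (card V'))"
      and pos: "0 < real (card V')" by simp_all
    then show ?thesis
      unfolding average_degree_def pos_divide_le_eq[OF pos] by (simp only: mult.assoc)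
  qed
  then have sparse: "\<forall>V' E'. proper_subgraph V' E' V E \<longrightarrow> average_degree V' E' \<le> 2 * (real k - 1)"
    by (intro allI impI)
  show ?thesis
    by (rule exI[of _ V], rule exI[of _ E], rule exI[of _ L],
        intro conjI simple bip assignment uncolourable colours girth_ge sparse)
qed

end
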